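(* Let $\kappa$ be a cardinal and let $\langle X_\alpha:\alpha<\kappa\rangle$ be $T_0$ topological spaces. If the ordinal $\sup\{\operatorname{ps}(X_\alpha):\alpha<\kappa\}$ is $\kappa$-decomposable, then $$\operatorname{ps}\Big(\prod_{\alpha<\kappa}X_\alpha\Big)=\sup\{\operatorname{ps}(X_\alpha):\alpha<\kappa\},$$ where the product carries the product topology.
   Context: Point separating game $G_\beta(X)$ ($X$ a topological space, $\beta$ an ordinal): two players, Seeker and Hider, make $\beta$ moves. At move $\alpha<\beta$, knowing all previous moves, the Seeker chooses an open set $U_\alpha\subseteq X$, and then the Hider chooses $V_\alpha\in\{U_\alpha, X\setminus U_\alpha\}$. The outcome is $W=\bigcap_{\alpha<\beta}V_\alpha$ (with $W=X$ if $\beta=0$). The Seeker wins iff $|W|\le 1$. For a $T_0$ space $X$, $\operatorname{ps}(X)$ is the least ordinal $\beta$ such that the Seeker has a winning strategy in $G_\beta(X)$. An ordinal $\delta$ is $\kappa$-decomposable ($\kappa$ a cardinal) if $\delta$ can be partitioned into $\kappa$ subsets, each of order type $\delta$.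
   Formalization: The spaces X_α are assumed nonempty; otherwise the claim fails, e.g. for κ = 2, X_0 empty and X_1 the Cantor space, where the supremum is ω (which is 2-decomposable) but the product is empty and has ps = 0. *)

theory Defs
  imports "HOL-Analysis.Analysis"
begin

unbundle cardinal_syntax

text \<open>
  Ordinals are represented by well-orders \<open>r\<close> (in the sense of \<^term>\<open>Well_order r\<close>), equality and
  comparison of ordinals by \<open>=o\<close>, \<open>\<le>o\<close> and \<open><o\<close>.  The ordinals \<open>\<alpha> < \<beta>\<close> correspond to the elements
  of the field of the well-order representing \<open>\<beta>\<close>.
\<close>

subsection \<open>The point separating game\<close>

text \<open>
  The moves of a play are given by \<open>U\<close> (Seeker) and \<open>V\<close> (Hider).  A strategy of the Seeker sends a
  position \<open>\<alpha>\<close> and the sequence of all earlier moves, which is \<^term>\<open>undefined\<close> outside of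
  \<^term>\<open>underS \<beta> \<alpha>\<close>, to the set to be played.
\<close>

definition ps_strategy ::
  "'b rel \<Rightarrow> 'a topology \<Rightarrow> ('b \<Rightarrow> ('b \<Rightarrow> 'a set \<times> 'a set) \<Rightarrow> 'a set) \<Rightarrow> bool" where
  "ps_strategy \<beta> X \<sigma> \<longleftrightarrow> (\<forall>\<alpha>\<in>Field \<beta>. \<forall>h. openin X (\<sigma> \<alpha> h))"

definition ps_play :: "'b rel \<Rightarrow> 'a topology \<Rightarrow> ('b \<Rightarrow> 'a set) \<Rightarrow> ('b \<Rightarrow> 'a set) \<Rightarrow> bool" where
  "ps_play \<beta> X U V \<longleftrightarrow>
     (\<forall>\<alpha>\<in>Field \<beta>. openin X (U \<alpha>) \<and> V \<alpha> \<in> {U \<alpha>, topspace X - U \<alpha>})"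

definition follows ::
  "'b rel \<Rightarrow> ('b \<Rightarrow> ('b \<Rightarrow> 'a set \<times> 'a set) \<Rightarrow> 'a set) \<Rightarrow> ('b \<Rightarrow> 'a set) \<Rightarrow> ('b \<Rightarrow> 'a set) \<Rightarrow> bool" where
  "follows \<beta> \<sigma> U V \<longleftrightarrow>
     (\<forall>\<alpha>\<in>Field \<beta>. U \<alpha> = \<sigma> \<alpha> (restrict (\<lambda>\<gamma>. (U \<gamma>, V \<gamma>)) (underS \<beta> \<alpha>)))"

definition ps_outcome :: "'b rel \<Rightarrow> 'a topology \<Rightarrow> ('b \<Rightarrow> 'a set) \<Rightarrow> 'a set" where
  "ps_outcome \<beta> X V = topspace X \<inter> (\<Inter>\<alpha>\<in>Field \<beta>. V \<alpha>)"

definition seeker_wins :: "'b rel \<Rightarrow> 'a topology \<Rightarrow> bool" where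
  "seeker_wins \<beta> X \<longleftrightarrow>
     (\<exists>\<sigma>. ps_strategy \<beta> X \<sigma> \<and>
        (\<forall>U V. ps_play \<beta> X U V \<and> follows \<beta> \<sigma> U V \<longrightarrow>
           finite (ps_outcome \<beta> X V) \<and> card (ps_outcome \<beta> X V) \<le> 1))"


subsection \<open>Least ordinals, \<open>ps\<close> and suprema\<close>

definition least_ord :: "('c rel \<Rightarrow> bool) \<Rightarrow> 'c rel" where
  "least_ord P = (SOME r. Well_order r \<and> P r \<and> (\<forall>r'. Well_order r' \<and> P r' \<longrightarrow> r \<le>o r'))"

text \<open>
  The type of the field must be large enough to carry the ordinal in question.  The lemmas at the
  end show that this is the case, and that the ordinals obtained are least among the well-orders on
  all types.
\<close>

definition ps :: "'a topology \<Rightarrow> 'a set rel" where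
  "ps X = least_ord (\<lambda>\<beta>. seeker_wins \<beta> X)"

definition ord_Sup :: "'b rel set \<Rightarrow> 'b set rel" where
  "ord_Sup S = least_ord (\<lambda>\<delta>. \<forall>s\<in>S. s \<le>o \<delta>)"


subsection \<open>Decomposable ordinals\<close>

text \<open>
  A partition into \<open>\<kappa>\<close> sets is an indexed family of disjoint sets.  The sets may be empty, which
  matters only for \<open>\<delta> = 0\<close>: the ordinal 0 is \<open>\<kappa>\<close>-decomposable for all \<open>\<kappa>\<close>.
\<close>

definition decomposable :: "'i rel \<Rightarrow> 'b rel \<Rightarrow> bool" where
  "decomposable \<kappa> \<delta> \<longleftrightarrow>
     (\<exists>P. disjoint_family_on P (Field \<kappa>) \<and> (\<Union>i\<in>Field \<kappa>. P i) = Field \<delta> \<and>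
          (\<forall>i\<in>Field \<kappa>. Restr \<delta> (P i) =o \<delta>))"


subsection \<open>Well-definedness\<close>

lemma least_ord:
  assumes "Well_order r" "P r"
  shows "Well_order (least_ord P)" "P (least_ord P)"
    "\<And>r'. Well_order r' \<Longrightarrow> P r' \<Longrightarrow> least_ord P \<le>o r'"
proof -
  let ?R = "{r. Well_order r \<and> P r}"
  have "r \<in> ?R" using assms by simp
  then have "?R \<noteq> {}" by (metis empty_iff)
  moreover have "\<forall>r\<in>?R. Well_order r" by simp
  ultimately obtain m where "m \<in> ?R" "\<forall>r'\<in>?R. m \<le>o r'"
    by (rule bexE[OF exists_minim_Well_order])
  then have "\<exists>r. Well_order r \<and> P r \<and> (\<forall>r'. Well_order r' \<and> P r' \<longrightarrow> r \<le>o r')"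
    by (intro exI[of _ m]) simp
  from someI_ex[OF this]
  have *: "Well_order (least_ord P) \<and> P (least_ord P) \<and>
      (\<forall>r'. Well_order r' \<and> P r' \<longrightarrow> least_ord P \<le>o r')"
    unfolding least_ord_def .
  from * show "Well_order (least_ord P)" by (rule conjunct1)
  from * show "P (least_ord P)" by (elim conjE)
  show "least_ord P \<le>o r'" if "Well_order r'" "P r'" for r'
    using * that by (elim conjE) simp
qed

lemma least_ord_all_types:
  fixes P :: "'c rel \<Rightarrow> bool" and Q :: "'d rel \<Rightarrow> bool"
  assumes "Well_order r" "P r"
    and transfer: "\<And>r r'. r =o r' \<Longrightarrow> Q r \<Longrightarrow> P r'"
    and r': "Well_order r'" "Q r'"
  shows "least_ord P \<le>o r'"
proof (rule ccontr)
  let ?l = "least_ord P"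
  have wo: "Well_order ?l" by (rule least_ord(1)[of r P, OF assms(1,2)])
  assume "\<not> ?l \<le>o r'"
  then have less: "r' <o ?l" unfolding not_ordLeq_iff_ordLess[OF r'(1) wo] .
  obtain a where a: "a \<in> Field ?l" "r' =o Restr ?l (underS ?l a)"
    by (rule bexE[OF iffD1[OF ordLess_iff_ordIso_Restr[OF wo r'(1)] less]])
  define s where "s = Restr ?l (underS ?l a)"
  have "Well_order s" unfolding s_def by (rule Well_order_Restr[OF wo])
  moreover have "P s" using a(2) r'(2) unfolding s_def[symmetric] by (rule transfer)
  ultimately have "?l \<le>o s" by (rule least_ord(3)[of r P, OF assms(1,2)])
  moreover have "s <o ?l"
    unfolding s_def by (rule underS_Restr_ordLess[OF wo]) (use a(1) in auto)
  then have "\<not> ?l \<le>o s" by (rule not_ordLess_ordLeq)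
  ultimately show False by contradiction
qed

lemma seeker_wins_ordIso:
  fixes r :: "'b rel" and r' :: "'c rel"
  assumes iso: "r =o r'" and win: "seeker_wins r X"
  shows "seeker_wins r' X"
proof -
  obtain f where wo: "Well_order r" "Well_order r'" and f: "iso r r' f"
    using iso unfolding ordIso_def by auto
  have bij: "bij_betw f (Field r) (Field r')"
    and mono: "\<And>a b. a \<in> Field r \<Longrightarrow> b \<in> Field r \<Longrightarrow> (a, b) \<in> r \<longleftrightarrow> (f a, f b) \<in> r'"
    using f unfolding iso_iff2 by auto
  define g where "g = inv_into (Field r) f"
  have gf: "g (f a) = a" if "a \<in> Field r" for a
    using that bij unfolding g_def by (simp add: bij_betw_inv_into_left)
  have fF: "f a \<in> Field r'" if "a \<in> Field r" for a
    using that bij by (auto simp: bij_betw_def)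
  have gF: "g b \<in> Field r" and fg: "f (g b) = b" if "b \<in> Field r'" for b
    using that bij unfolding g_def
    by (auto simp: bij_betw_def inv_into_into f_inv_into_f)
  have under: "f c \<in> underS r' (f a)" if "c \<in> underS r a" for a c
  proof -
    have "c \<noteq> a" "(c, a) \<in> r" using that by (auto simp: underS_def)
    moreover from this have "c \<in> Field r" "a \<in> Field r" by (auto intro: FieldI1 FieldI2)
    ultimately show ?thesis using mono[of c a] gf[of c] gf[of a] unfolding underS_def by force
  qed
  obtain \<sigma> where \<sigma>: "ps_strategy r X \<sigma>"
    and W: "\<And>U V. ps_play r X U V \<Longrightarrow> follows r \<sigma> U V \<Longrightarrow>
           finite (ps_outcome r X V) \<and> card (ps_outcome r X V) \<le> 1"
    using win unfolding seeker_wins_def by blast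
  define \<tau> where "\<tau> = (\<lambda>\<alpha> h. \<sigma> (g \<alpha>) (restrict (\<lambda>\<gamma>. h (f \<gamma>)) (underS r (g \<alpha>))))"
  have "ps_strategy r' X \<tau>"
    using \<sigma> gF unfolding ps_strategy_def \<tau>_def by blast
  moreover have "finite (ps_outcome r' X V) \<and> card (ps_outcome r' X V) \<le> 1"
    if p: "ps_play r' X U V" and fo: "follows r' \<tau> U V" for U V
  proof -
    have "ps_play r X (U \<circ> f) (V \<circ> f)"
      using p fF unfolding ps_play_def by auto
    moreover have "follows r \<sigma> (U \<circ> f) (V \<circ> f)"
      unfolding follows_def
    proof
      fix a assume a: "a \<in> Field r"
      have "U (f a) = \<tau> (f a) (restrict (\<lambda>\<gamma>. (U \<gamma>, V \<gamma>)) (underS r' (f a)))"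
        using fo fF[OF a] unfolding follows_def by blast
      also have "\<dots> = \<sigma> a (restrict (\<lambda>\<gamma>. (U (f \<gamma>), V (f \<gamma>))) (underS r a))"
        unfolding \<tau>_def gf[OF a] using under[of _ a]
        by (intro arg_cong[where f = "\<sigma> a"] restrict_ext) auto
      finally show "(U \<circ> f) a = \<sigma> a (restrict (\<lambda>\<gamma>. ((U \<circ> f) \<gamma>, (V \<circ> f) \<gamma>)) (underS r a))"
        by simp
    qed
    moreover have "ps_outcome r X (V \<circ> f) = ps_outcome r' X V"
      using bij unfolding ps_outcome_def bij_betw_def by (metis image_comp)
    ultimately show ?thesis using W by metis
  qed
  ultimately show ?thesis unfolding seeker_wins_def by blast
qed

lemma seeker_wins_card_of_UNIV:
  fixes X :: "'a topology"
  assumes "t0_space X"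
  shows "seeker_wins |UNIV :: 'a set set| X"
  unfolding seeker_wins_def
proof (intro exI conjI allI impI)
  let ?\<sigma> = "\<lambda>\<alpha> (h :: 'a set \<Rightarrow> 'a set \<times> 'a set). if openin X \<alpha> then \<alpha> else {}"
  show "ps_strategy |UNIV :: 'a set set| X ?\<sigma>" by (simp add: ps_strategy_def)
  fix U V
  assume *: "ps_play |UNIV :: 'a set set| X U V \<and> follows |UNIV :: 'a set set| ?\<sigma> U V"
  let ?W = "ps_outcome |UNIV :: 'a set set| X V"
  have F: "Field |UNIV :: 'a set set| = UNIV" by (rule Field_card_of)
  have W: "?W = topspace X \<inter> (\<Inter>A. V A)" unfolding ps_outcome_def F ..
  have V: "V A = A \<or> V A = topspace X - A" if "openin X A" for A
  proof -
    have "U A = A"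
      using * that unfolding follows_def F by simp
    moreover have "V A \<in> {U A, topspace X - U A}"
      using * unfolding ps_play_def F by simp
    ultimately show ?thesis by simp
  qed
  have "x = y" if "x \<in> ?W" "y \<in> ?W" for x y
  proof (rule ccontr)
    have xy: "x \<in> topspace X" "y \<in> topspace X" "\<And>A. x \<in> V A" "\<And>A. y \<in> V A"
      using that unfolding W by simp_all
    assume "x \<noteq> y"
    then obtain A where A: "openin X A" "x \<notin> A \<longleftrightarrow> y \<in> A"
      using assms xy(1,2) unfolding t0_space_def by meson
    from V[OF A(1)] show False
      using A(2) xy(3,4)[of A] by (elim disjE) simp_all
  qed
  then have "is_singleton ?W \<or> ?W = {}"
    unfolding is_singleton_def by (metis is_singletonI' is_singleton_def)
  then have "finite ?W \<and> card ?W \<le> 1"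
    unfolding is_singleton_def by (elim disjE exE) simp_all
  then show "finite ?W" "card ?W \<le> 1" by simp_all
qed

lemma ps:
  assumes "t0_space X"
  shows "Well_order (ps X)" "seeker_wins (ps X) X"
    "\<And>r :: 'b rel. Well_order r \<Longrightarrow> seeker_wins r X \<Longrightarrow> ps X \<le>o r"
proof -
  note wo = card_of_Well_order and win = seeker_wins_card_of_UNIV[OF assms]
  show "Well_order (ps X)" "seeker_wins (ps X) X"
    unfolding ps_def by (fact least_ord(1,2)[of _ "\<lambda>\<beta>. seeker_wins \<beta> X", OF wo win])+
  fix r :: "'b rel"
  assume r: "Well_order r" "seeker_wins r X"
  show "ps X \<le>o r"
    unfolding ps_def
    by (rule least_ord_all_types[of _ "\<lambda>\<beta>. seeker_wins \<beta> X" "\<lambda>\<beta>. seeker_wins \<beta> X" r,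
          OF wo win seeker_wins_ordIso r])
qed

lemma ord_Sup:
  fixes S :: "'c rel set"
  assumes S: "\<And>s. s \<in> S \<Longrightarrow> Well_order s"
  shows "Well_order (ord_Sup S)" "\<And>s. s \<in> S \<Longrightarrow> s \<le>o ord_Sup S"
    "\<And>r :: 'b rel. Well_order r \<Longrightarrow> (\<And>s. s \<in> S \<Longrightarrow> s \<le>o r) \<Longrightarrow> ord_Sup S \<le>o r"
proof -
  let ?u = "|UNIV :: 'c set set|"
  have wo: "Well_order ?u" by (rule card_of_Well_order)
  have ub: "\<forall>s\<in>S. s \<le>o ?u"
  proof (intro ballI, rule ccontr)
    fix s assume s: "s \<in> S" and "\<not> s \<le>o ?u"
    then have "?u \<le>o s"
      using not_ordLeq_iff_ordLess[OF wo S[OF s]] ordLess_imp_ordLeq[of ?u s] by simp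
    then have "|Field ?u| \<le>o |Field s|" by (rule card_of_mono2)
    then have "?u \<le>o |Field s|" by (simp add: Field_card_of)
    moreover have "|Field s| \<le>o |UNIV :: 'c set|" by (rule card_of_mono1) simp
    ultimately have "?u \<le>o |UNIV :: 'c set|" by (rule ordLeq_transitive)
    moreover have "|UNIV :: 'c set| <o ?u" using card_of_Pow[of "UNIV :: 'c set"] by simp
    ultimately show False using not_ordLess_ordLeq[of "|UNIV :: 'c set|" ?u] by simp
  qed
  show "Well_order (ord_Sup S)" "\<And>s. s \<in> S \<Longrightarrow> s \<le>o ord_Sup S"
    unfolding ord_Sup_def
    using least_ord(1,2)[of _ "\<lambda>\<delta>. \<forall>s\<in>S. s \<le>o \<delta>", OF wo ub] by simp_all
  fix r :: "'b rel"
  assume r: "Well_order r" "\<And>s. s \<in> S \<Longrightarrow> s \<le>o r"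
  show "ord_Sup S \<le>o r"
    unfolding ord_Sup_def
  proof (rule least_ord_all_types[of _ "\<lambda>\<delta>. \<forall>s\<in>S. s \<le>o \<delta>" "\<lambda>\<delta>. \<forall>s\<in>S. s \<le>o \<delta>" r, OF wo ub])
    show "\<forall>s\<in>S. s \<le>o b" if "a =o b" "\<forall>s\<in>S. s \<le>o a" for a :: "'b rel" and b :: "'c set rel"
      using that by (auto intro: ordLeq_ordIso_trans[of _ a b])
  qed (use r in auto)
qed

end

(* Seeker's knowledge of the past is determined by the set A of earlier positions at which Hider
   accepted the offered set, so a strategy may be taken to be a function of A alone.  In this form
   strategies pull back along continuous injections, which gives the lower bound through the slices
   of the product.  For the upper bound Seeker uses the positions in the i-th part of the
   decomposition to play the game on the i-th factor, ignoring the moves made elsewhere. *)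

theory Submission
  imports Defs
begin

section \<open>Strategies that depend only on the accepted positions\<close>

text \<open>\<open>A\<close> encodes a whole play of Hider: the positions where the offered set is
  accepted. Passing \<open>A \<inter> underS \<beta> \<alpha>\<close> hides the present and future
  moves from Seeker, and a point survives the play iff it lies in the offered set exactly at the
  positions in \<open>A\<close>.\<close>

definition separating_strategy :: "'b rel \<Rightarrow> 'a topology \<Rightarrow> ('b \<Rightarrow> 'b set \<Rightarrow> 'a set) \<Rightarrow> bool" where
  "separating_strategy \<beta> X \<tau> \<longleftrightarrow>
     (\<forall>\<alpha>\<in>Field \<beta>. \<forall>A. openin X (\<tau> \<alpha> A)) \<and>
     (\<forall>A. \<forall>x\<in>topspace X. \<forall>y\<in>topspace X.
        (\<forall>\<alpha>\<in>Field \<beta>. (x \<in> \<tau> \<alpha> (A \<inter> underS \<beta> \<alpha>) \<longleftrightarrow> \<alpha> \<in> A) \<and> (y \<in> \<tau> \<alpha> (A \<inter> underS \<beta> \<alpha>) \<longleftrightarrow> \<alpha> \<in> A))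
        \<longrightarrow> x = y)"

lemma separating_strategyI:
  assumes "\<And>\<alpha> A. \<alpha> \<in> Field \<beta> \<Longrightarrow> openin X (\<tau> \<alpha> A)"
    and "\<And>A x y. \<lbrakk>x \<in> topspace X; y \<in> topspace X;
           \<And>\<alpha>. \<alpha> \<in> Field \<beta> \<Longrightarrow> x \<in> \<tau> \<alpha> (A \<inter> underS \<beta> \<alpha>) \<longleftrightarrow> \<alpha> \<in> A;
           \<And>\<alpha>. \<alpha> \<in> Field \<beta> \<Longrightarrow> y \<in> \<tau> \<alpha> (A \<inter> underS \<beta> \<alpha>) \<longleftrightarrow> \<alpha> \<in> A\<rbrakk> \<Longrightarrow> x = y"
  shows "separating_strategy \<beta> X \<tau>"
  unfolding separating_strategy_def using assms by blast

lemma separating_strategy_openin: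
  "separating_strategy \<beta> X \<tau> \<Longrightarrow> \<alpha> \<in> Field \<beta> \<Longrightarrow> openin X (\<tau> \<alpha> A)"
  unfolding separating_strategy_def by blast

lemma separating_strategy_eq:
  assumes "separating_strategy \<beta> X \<tau>" "x \<in> topspace X" "y \<in> topspace X"
    and "\<And>\<alpha>. \<alpha> \<in> Field \<beta> \<Longrightarrow> x \<in> \<tau> \<alpha> (A \<inter> underS \<beta> \<alpha>) \<longleftrightarrow> \<alpha> \<in> A"
    and "\<And>\<alpha>. \<alpha> \<in> Field \<beta> \<Longrightarrow> y \<in> \<tau> \<alpha> (A \<inter> underS \<beta> \<alpha>) \<longleftrightarrow> \<alpha> \<in> A"
  shows "x = y"
  using assms unfolding separating_strategy_def by blast

lemma seeker_wins_if_separating_strategy: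
  assumes \<tau>: "separating_strategy \<beta> X \<tau>"
  shows "seeker_wins \<beta> X"
  unfolding seeker_wins_def
proof (intro exI conjI allI impI)
  \<comment> \<open>A move was accepted iff its two entries coincide. The intersection discards
    positions where the history is \<open>undefined\<close> and this test means nothing.\<close>
  let ?\<sigma> = "\<lambda>\<alpha> h. \<tau> \<alpha> ({\<gamma>. snd (h \<gamma>) = fst (h \<gamma>)} \<inter> underS \<beta> \<alpha>)"
  show "ps_strategy \<beta> X ?\<sigma>"
    using separating_strategy_openin[OF \<tau>] unfolding ps_strategy_def by blast
  fix U V
  assume play: "ps_play \<beta> X U V \<and> follows \<beta> ?\<sigma> U V"
  define A where "A = {\<gamma>. V \<gamma> = U \<gamma>}"
  have V: "V \<alpha> \<in> {U \<alpha>, topspace X - U \<alpha>}" if "\<alpha> \<in> Field \<beta>" for \<alpha>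
    using play that unfolding ps_play_def by blast
  have U: "U \<alpha> = \<tau> \<alpha> (A \<inter> underS \<beta> \<alpha>)" if "\<alpha> \<in> Field \<beta>" for \<alpha>
  proof -
    have "U \<alpha> = ?\<sigma> \<alpha> (restrict (\<lambda>\<gamma>. (U \<gamma>, V \<gamma>)) (underS \<beta> \<alpha>))"
      using play that unfolding follows_def by blast
    also have "\<dots> = \<tau> \<alpha> (A \<inter> underS \<beta> \<alpha>)"
      unfolding A_def by (rule arg_cong[where f = "\<tau> \<alpha>"]) auto
    finally show ?thesis .
  qed
  have mem: "x \<in> \<tau> \<alpha> (A \<inter> underS \<beta> \<alpha>) \<longleftrightarrow> \<alpha> \<in> A"
    if "x \<in> ps_outcome \<beta> X V" "\<alpha> \<in> Field \<beta>" for x \<alpha>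
  proof -
    have "x \<in> topspace X" "x \<in> V \<alpha>" using that unfolding ps_outcome_def by auto
    \<comment> \<open>The surviving point \<open>x\<close> shows that \<open>U \<alpha>\<close> and
      its complement differ, so acceptance is unambiguous here.\<close>
    then have "x \<in> U \<alpha> \<longleftrightarrow> V \<alpha> = U \<alpha>" using V[OF that(2)] by auto
    then show ?thesis using U[OF that(2)] by (simp add: A_def)
  qed
  have eq: "x = y" if "x \<in> ps_outcome \<beta> X V" "y \<in> ps_outcome \<beta> X V" for x y
    using separating_strategy_eq[OF \<tau>, of x y A] mem that unfolding ps_outcome_def by blast
  then obtain x where "ps_outcome \<beta> X V \<subseteq> {x}" by blast
  then show "finite (ps_outcome \<beta> X V)" "card (ps_outcome \<beta> X V) \<le> 1"
    using finite_subset[of _ "{x}"] card_mono[of "{x}"] by auto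
qed

text \<open>Given \<open>\<sigma>\<close>, the set \<open>A\<close> determines the whole play:
  Seeker's moves by well-founded recursion, Hider's by membership in \<open>A\<close>. The new
  strategy offers at \<open>\<alpha>\<close> the set that this play reaches there.\<close>

lemma separating_strategy_if_seeker_wins:
  fixes \<beta> :: "'b rel" and X :: "'a topology"
  assumes wo: "Well_order \<beta>" and win: "seeker_wins \<beta> X"
  obtains \<tau> where "separating_strategy \<beta> X \<tau>"
proof -
  obtain \<sigma> where \<sigma>: "ps_strategy \<beta> X \<sigma>"
    and W: "\<And>U V. ps_play \<beta> X U V \<Longrightarrow> follows \<beta> \<sigma> U V \<Longrightarrow>
           finite (ps_outcome \<beta> X V) \<and> card (ps_outcome \<beta> X V) \<le> 1"
    using win unfolding seeker_wins_def by blast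
  have wf: "wf (\<beta> - Id)" and tr: "trans \<beta>" and as: "antisym \<beta>"
    using wo by (auto simp: order_on_defs)
  \<comment> \<open>The pair of moves at \<open>\<gamma>\<close> when Seeker offers
    \<open>u \<gamma>\<close> and Hider answers as \<open>A\<close> prescribes.\<close>
  define N where "N = (\<lambda>A (u :: 'b \<Rightarrow> 'a set) \<gamma>. (u \<gamma>, if \<gamma> \<in> A then u \<gamma> else topspace X - u \<gamma>))"
  define U where
    "U A = wfrec (\<beta> - Id) (\<lambda>u \<alpha>. \<sigma> \<alpha> (restrict (N A u) (underS \<beta> \<alpha>)))" for A
  have U: "U A \<alpha> = \<sigma> \<alpha> (restrict (N A (U A)) (underS \<beta> \<alpha>))" for A \<alpha>
  proof -
    have "U A \<alpha> = \<sigma> \<alpha> (restrict (N A (cut (U A) (\<beta> - Id) \<alpha>)) (underS \<beta> \<alpha>))"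
      unfolding U_def using wf by (subst wfrec) simp_all
    also have "\<dots> = \<sigma> \<alpha> (restrict (N A (U A)) (underS \<beta> \<alpha>))"
      by (intro arg_cong[where f = "\<sigma> \<alpha>"] restrict_ext) (auto simp: N_def cut_def underS_def)
    finally show ?thesis .
  qed
  \<comment> \<open>Locality: the set offered at \<open>\<alpha>\<close> depends only on the part of
    \<open>A\<close> below \<open>\<alpha>\<close>.\<close>
  have cong: "U A \<alpha> = U B \<alpha>" if "A \<inter> underS \<beta> \<alpha> = B \<inter> underS \<beta> \<alpha>" for A B \<alpha>
    using wf that
  proof (induction \<alpha> rule: wf_induct_rule)
    case (less \<alpha>)
    have "N A (U A) \<gamma> = N B (U B) \<gamma>" if \<gamma>: "\<gamma> \<in> underS \<beta> \<alpha>" for \<gamma>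
    proof -
      have "underS \<beta> \<gamma> \<subseteq> underS \<beta> \<alpha>"
        using \<gamma> by (intro underS_incr[OF tr as]) (simp add: underS_def)
      then have "U A \<gamma> = U B \<gamma>"
        using less.prems \<gamma> by (intro less.IH) (auto simp: underS_def)
      then show ?thesis using less.prems \<gamma> by (auto simp: N_def)
    qed
    then show ?case unfolding U[of _ \<alpha>] by (metis restrict_ext)
  qed
  show thesis
  proof (rule that, rule separating_strategyI)
    have op: "openin X (U A \<alpha>)" if "\<alpha> \<in> Field \<beta>" for A \<alpha>
      using \<sigma> that unfolding ps_strategy_def U[of A \<alpha>] by blast
    then show "openin X (U A \<alpha>)" if "\<alpha> \<in> Field \<beta>" for A \<alpha> using that .
    fix A x y
    assume xy: "x \<in> topspace X" "y \<in> topspace X"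
      and x: "\<And>\<alpha>. \<alpha> \<in> Field \<beta> \<Longrightarrow> x \<in> U (A \<inter> underS \<beta> \<alpha>) \<alpha> \<longleftrightarrow> \<alpha> \<in> A"
      and y: "\<And>\<alpha>. \<alpha> \<in> Field \<beta> \<Longrightarrow> y \<in> U (A \<inter> underS \<beta> \<alpha>) \<alpha> \<longleftrightarrow> \<alpha> \<in> A"
    \<comment> \<open>The truncations of \<open>A\<close> vary with \<open>\<alpha>\<close>; by
      locality the offered sets nevertheless belong to one play, to which the winning property of
      \<open>\<sigma>\<close> applies.\<close>
    have [simp]: "U (A \<inter> underS \<beta> \<alpha>) \<alpha> = U A \<alpha>" for \<alpha>
      by (rule cong) auto
    define V where "V \<alpha> = snd (N A (U A) \<alpha>)" for \<alpha>
    have "ps_play \<beta> X (U A) V"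
      using op unfolding ps_play_def V_def N_def by auto
    moreover have "(\<lambda>\<gamma>. (U A \<gamma>, V \<gamma>)) = N A (U A)"
      by (simp add: V_def N_def fun_eq_iff)
    then have "follows \<beta> \<sigma> (U A) V"
      unfolding follows_def by (simp only:) (intro ballI U)
    ultimately have W: "finite (ps_outcome \<beta> X V)" "card (ps_outcome \<beta> X V) \<le> 1"
      using W by blast+
    have "x \<in> ps_outcome \<beta> X V" "y \<in> ps_outcome \<beta> X V"
      using x y xy unfolding ps_outcome_def V_def N_def by auto
    then show "x = y"
      using W card_le_Suc0_iff_eq[OF W(1)] by auto
  qed
qed

section \<open>Transfer to other spaces and longer games\<close>

text \<open>Seeker offers preimages. Two points surviving a play on \<open>X\<close> have images
  surviving the play on \<open>Y\<close> with the same \<open>A\<close>, so the images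
  coincide.\<close>

lemma seeker_wins_continuous_inj:
  assumes wo: "Well_order \<beta>" and win: "seeker_wins \<beta> Y"
    and f: "continuous_map X Y f" "inj_on f (topspace X)"
  shows "seeker_wins \<beta> X"
proof -
  obtain \<tau> where \<tau>: "separating_strategy \<beta> Y \<tau>"
    using separating_strategy_if_seeker_wins[OF wo win] .
  have "separating_strategy \<beta> X (\<lambda>\<alpha> A. {x \<in> topspace X. f x \<in> \<tau> \<alpha> A})"
  proof (rule separating_strategyI)
    show "openin X {x \<in> topspace X. f x \<in> \<tau> \<alpha> A}" if "\<alpha> \<in> Field \<beta>" for \<alpha> A
      using f(1) separating_strategy_openin[OF \<tau> that] by (rule openin_continuous_map_preimage)
    fix A x y
    assume xy: "x \<in> topspace X" "y \<in> topspace X"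
      and "\<And>\<alpha>. \<alpha> \<in> Field \<beta> \<Longrightarrow> x \<in> {x \<in> topspace X. f x \<in> \<tau> \<alpha> (A \<inter> underS \<beta> \<alpha>)} \<longleftrightarrow> \<alpha> \<in> A"
        "\<And>\<alpha>. \<alpha> \<in> Field \<beta> \<Longrightarrow> y \<in> {x \<in> topspace X. f x \<in> \<tau> \<alpha> (A \<inter> underS \<beta> \<alpha>)} \<longleftrightarrow> \<alpha> \<in> A"
    then have "f x = f y"
      using f(1) by (intro separating_strategy_eq[OF \<tau>, of _ _ A]) (auto simp: continuous_map_def)
    then show "x = y" using f(2) xy by (simp add: inj_on_def)
  qed
  then show ?thesis by (rule seeker_wins_if_separating_strategy)
qed

text \<open>The shorter game is played on the initial segment onto which \<open>f\<close> embeds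
  \<open>r\<close>; at later positions Seeker offers the empty set.\<close>

lemma seeker_wins_mono:
  assumes le: "r \<le>o r'" and win: "seeker_wins r X"
  shows "seeker_wins r' X"
proof -
  obtain f where wo: "Well_order r" "Well_order r'" and f: "embed r r' f"
    using le unfolding ordLeq_def by auto
  obtain \<tau> where \<tau>: "separating_strategy r X \<tau>"
    using separating_strategy_if_seeker_wins[OF wo(1) win] .
  have inj: "inj_on f (Field r)" using f wo(1) by (rule embed_inj_on[rotated])
  have fF: "f a \<in> Field r'" if "a \<in> Field r" for a
    using f that by (rule embed_in_Field)
  have under: "f ` underS r a = underS r' (f a)" if "a \<in> Field r" for a
    using embed_underS[OF wo(1) f that] by (simp add: bij_betw_def)
  let ?\<tau>' = "\<lambda>\<alpha> A. if \<alpha> \<in> f ` Field r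
     then \<tau> (inv_into (Field r) f \<alpha>) {c \<in> Field r. f c \<in> A} else {}"
  have "separating_strategy r' X ?\<tau>'"
  proof (rule separating_strategyI)
    show "openin X (?\<tau>' \<alpha> A)" for \<alpha> A
      using separating_strategy_openin[OF \<tau>] by (auto simp: inj)
    fix A x y
    assume xy: "x \<in> topspace X" "y \<in> topspace X"
      and x: "\<And>\<alpha>. \<alpha> \<in> Field r' \<Longrightarrow> x \<in> ?\<tau>' \<alpha> (A \<inter> underS r' \<alpha>) \<longleftrightarrow> \<alpha> \<in> A"
      and y: "\<And>\<alpha>. \<alpha> \<in> Field r' \<Longrightarrow> y \<in> ?\<tau>' \<alpha> (A \<inter> underS r' \<alpha>) \<longleftrightarrow> \<alpha> \<in> A"
    let ?B = "{c \<in> Field r. f c \<in> A}"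
    \<comment> \<open>Since \<open>f\<close> maps the predecessors of \<open>a\<close> onto those of
      \<open>f a\<close>, the past pulls back to exactly the past of the shorter game.\<close>
    have "?\<tau>' (f a) (A \<inter> underS r' (f a)) = \<tau> a (?B \<inter> underS r a)" if a: "a \<in> Field r" for a
    proof -
      have "{c \<in> Field r. f c \<in> A \<inter> underS r' (f a)} = ?B \<inter> underS r a"
        using inj Order_Relation.underS_Field[of r a]
        unfolding under[OF a, symmetric] by (auto simp: inj_on_def)
      then show ?thesis using a by (simp add: inj)
    qed
    with x[OF fF] y[OF fF] show "x = y"
      by (intro separating_strategy_eq[OF \<tau> xy, of ?B]) simp_all
  qed
  then show ?thesis by (rule seeker_wins_if_separating_strategy)
qed

section \<open>Products and their factors\<close>

text \<open>At a position in \<open>P i\<close> Seeker offers the cylinder over the set that the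
  strategy for the \<open>i\<close>-th factor dictates. Surviving points then agree in every
  coordinate.\<close>

lemma seeker_wins_product:
  assumes wo: "Well_order \<delta>"
    and disj: "disjoint_family_on P I" and P: "\<And>i. i \<in> I \<Longrightarrow> P i \<subseteq> Field \<delta>"
    and win: "\<And>i. i \<in> I \<Longrightarrow> seeker_wins (Restr \<delta> (P i)) (X i)"
  shows "seeker_wins \<delta> (product_topology X I)"
proof -
  have "\<forall>i\<in>I. \<exists>\<tau>. separating_strategy (Restr \<delta> (P i)) (X i) \<tau>"
    using separating_strategy_if_seeker_wins[OF Well_order_Restr[OF wo] win] by metis
  then obtain \<tau> where \<tau>: "\<And>i. i \<in> I \<Longrightarrow> separating_strategy (Restr \<delta> (P i)) (X i) (\<tau> i)"
    by metis
  have F: "Field (Restr \<delta> (P i)) = P i" if "i \<in> I" for i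
    using Refl_Field_Restr2[of \<delta> "P i"] wo P[OF that] by (simp add: order_on_defs)
  let ?X = "product_topology X I"
  \<comment> \<open>The description is unique by disjointness, and it is used only at positions in
    some \<open>P i\<close>.\<close>
  define part where "part \<alpha> = (THE i. i \<in> I \<and> \<alpha> \<in> P i)" for \<alpha>
  have part: "part \<alpha> = i" if "i \<in> I" "\<alpha> \<in> P i" for i \<alpha>
    unfolding part_def using that disj by (intro the_equality) (auto simp: disjoint_family_on_def)
  let ?\<tau> = "\<lambda>\<alpha> A. if \<alpha> \<in> \<Union>(P ` I)
     then {x \<in> topspace ?X. x (part \<alpha>) \<in> \<tau> (part \<alpha>) \<alpha> (A \<inter> P (part \<alpha>))} else {}"
  have "separating_strategy \<delta> ?X ?\<tau>"
  proof (rule separating_strategyI)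
    show "openin ?X (?\<tau> \<alpha> A)" for \<alpha> A
    proof (cases "\<alpha> \<in> \<Union>(P ` I)")
      case True
      then obtain i where i: "i \<in> I" "\<alpha> \<in> P i" by blast
      have "openin ?X {x \<in> topspace ?X. x i \<in> \<tau> i \<alpha> (A \<inter> P i)}"
        using continuous_map_product_projection[OF i(1)]
          separating_strategy_openin[OF \<tau>[OF i(1)]] i(2) F[OF i(1)]
        by (intro openin_continuous_map_preimage) auto
      then show ?thesis using i True by (simp add: part)
    next
      case False
      then show ?thesis by (simp only: if_False openin_empty)
    qed
    fix A x y
    assume xy: "x \<in> topspace ?X" "y \<in> topspace ?X"
      and x: "\<And>\<alpha>. \<alpha> \<in> Field \<delta> \<Longrightarrow> x \<in> ?\<tau> \<alpha> (A \<inter> underS \<delta> \<alpha>) \<longleftrightarrow> \<alpha> \<in> A"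
      and y: "\<And>\<alpha>. \<alpha> \<in> Field \<delta> \<Longrightarrow> y \<in> ?\<tau> \<alpha> (A \<inter> underS \<delta> \<alpha>) \<longleftrightarrow> \<alpha> \<in> A"
    have "x i = y i" if i: "i \<in> I" for i
    proof (rule separating_strategy_eq[OF \<tau>[OF i], of _ _ A])
      show "x i \<in> topspace (X i)" "y i \<in> topspace (X i)"
        using xy i by (auto simp: PiE_iff)
      fix \<alpha> assume "\<alpha> \<in> Field (Restr \<delta> (P i))"
      then have \<alpha>: "\<alpha> \<in> P i" "\<alpha> \<in> Field \<delta>" using F[OF i] P[OF i] by auto
      \<comment> \<open>Forgetting the moves outside \<open>P i\<close> leaves precisely the past of
        the game on the \<open>i\<close>-th factor.\<close>
      have "A \<inter> underS (Restr \<delta> (P i)) \<alpha> = A \<inter> underS \<delta> \<alpha> \<inter> P i"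
        using \<alpha> by (auto simp: underS_def)
      then have "?\<tau> \<alpha> (A \<inter> underS \<delta> \<alpha>) =
          {x \<in> topspace ?X. x i \<in> \<tau> i \<alpha> (A \<inter> underS (Restr \<delta> (P i)) \<alpha>)}"
        using \<alpha>(1) i by (auto simp: part)
      with x[OF \<alpha>(2)] y[OF \<alpha>(2)] xy
      show "x i \<in> \<tau> i \<alpha> (A \<inter> underS (Restr \<delta> (P i)) \<alpha>) \<longleftrightarrow> \<alpha> \<in> A"
        "y i \<in> \<tau> i \<alpha> (A \<inter> underS (Restr \<delta> (P i)) \<alpha>) \<longleftrightarrow> \<alpha> \<in> A"
        by simp_all
    qed
    then show "x = y" using xy by (auto intro: PiE_ext)
  qed
  then show ?thesis by (rule seeker_wins_if_separating_strategy)
qed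

text \<open>The factor injects continuously into the product as the slice through a base point
  \<open>p\<close>. Nonempty factors supply \<open>p\<close>; an empty one would make the product
  empty and Seeker's win there trivial.\<close>

lemma seeker_wins_factor:
  assumes wo: "Well_order \<beta>" and win: "seeker_wins \<beta> (product_topology X I)"
    and ne: "\<And>j. j \<in> I \<Longrightarrow> topspace (X j) \<noteq> {}" and i: "i \<in> I"
  shows "seeker_wins \<beta> (X i)"
proof (rule seeker_wins_continuous_inj[OF wo win])
  define p where "p j = (SOME x. x \<in> topspace (X j))" for j
  have p: "p j \<in> topspace (X j)" if "j \<in> I" for j
    unfolding p_def using ne[OF that] by (simp add: some_in_eq)
  let ?f = "\<lambda>x. restrict (p(i := x)) I"
  show "continuous_map (X i) (product_topology X I) ?f"
    using p by (auto simp: continuous_map_componentwise)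
  show "inj_on ?f (topspace (X i))"
    using i by (auto simp: inj_on_def dest: fun_cong[of _ _ i])
qed

theorem theorem3p5:
  fixes \<kappa> :: "'i rel" and X :: "'i \<Rightarrow> 'a topology"
  assumes "Card_order \<kappa>"
    and "\<And>\<alpha>. \<alpha> \<in> Field \<kappa> \<Longrightarrow> t0_space (X \<alpha>)"
    and "\<And>\<alpha>. \<alpha> \<in> Field \<kappa> \<Longrightarrow> topspace (X \<alpha>) \<noteq> {}"
    and "decomposable \<kappa> (ord_Sup ((\<lambda>\<alpha>. ps (X \<alpha>)) ` Field \<kappa>))"
  shows "ps (product_topology X (Field \<kappa>)) =o ord_Sup ((\<lambda>\<alpha>. ps (X \<alpha>)) ` Field \<kappa>)"
proof -
  let ?S = "(\<lambda>\<alpha>. ps (X \<alpha>)) ` Field \<kappa>" and ?X = "product_topology X (Field \<kappa>)"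
  have S: "Well_order s" if "s \<in> ?S" for s
    using that ps(1)[OF assms(2)] by blast
  have "t0_space ?X"
    using assms(2) by (simp add: t0_space_product_topology)
  note psX = ps[OF this]
  obtain P where P: "disjoint_family_on P (Field \<kappa>)" "(\<Union>i\<in>Field \<kappa>. P i) = Field (ord_Sup ?S)"
      "\<And>i. i \<in> Field \<kappa> \<Longrightarrow> Restr (ord_Sup ?S) (P i) =o ord_Sup ?S"
    using assms(4) unfolding decomposable_def by blast
  \<comment> \<open>Each part has the order type of the supremum, hence is long enough for the game
    on its factor.\<close>
  have "seeker_wins (Restr (ord_Sup ?S) (P i)) (X i)" if i: "i \<in> Field \<kappa>" for i
  proof (rule seeker_wins_mono)
    show "seeker_wins (ps (X i)) (X i)" using assms(2)[OF i] by (rule ps(2))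
    have "ps (X i) \<le>o ord_Sup ?S" using ord_Sup(2)[OF S] i by blast
    then show "ps (X i) \<le>o Restr (ord_Sup ?S) (P i)"
      using ordIso_symmetric[OF P(3)[OF i]] by (rule ordLeq_ordIso_trans)
  qed
  then have "seeker_wins (ord_Sup ?S) ?X"
    using P(2) by (intro seeker_wins_product[OF ord_Sup(1)[OF S] P(1)]) auto
  then have "ps ?X \<le>o ord_Sup ?S"
    by (intro psX(3) ord_Sup(1)[OF S])
  \<comment> \<open>It suffices that \<open>ps ?X\<close> is an upper bound, which holds because a
    win on the product gives one of the same length on each factor.\<close>
  moreover have "ord_Sup ?S \<le>o ps ?X"
  proof (rule ord_Sup(3)[OF S psX(1)])
    fix s assume "s \<in> ?S"
    then obtain i where i: "i \<in> Field \<kappa>" "s = ps (X i)" by blast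
    have "seeker_wins (ps ?X) (X i)"
      using psX(1,2) assms(3) i(1) by (rule seeker_wins_factor)
    then show "s \<le>o ps ?X"
      unfolding i(2) by (rule ps(3)[OF assms(2)[OF i(1)] psX(1)])
  qed
  ultimately show ?thesis by (simp add: ordIso_iff_ordLeq)
qed

end
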